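(* Let $\mathbf{p}(t)$ be a planar rational cubic Bézier curve with control points $\mathbf{c}_0,\dots,\mathbf{c}_3\in\mathbb{R}^2$ and real weights $w_0,\dots,w_3$. Suppose all the weights are non-zero and no three of the control points are collinear. Then the curve $\mathbf{p}$ degenerates to a conic if and only if $\phi_1=0$ and $\phi_2=0$, where $$\phi_1=u_0u_2\lambda_1^2-u_1^2\lambda_0\lambda_2,\qquad\phi_2=u_1u_3\lambda_2^2-u_2^2\lambda_1\lambda_3 .$$
   Context: For $\mathbf{c}_i=(c_{i,0},c_{i,1})\in\mathbb{R}^2$ and real weights $w_i$ ($i=0,1,2,3$), the rational cubic Bézier curve is $$\mathbf{p}(t)=\frac{\mathbf{c}_0w_0(1-t)^3+3\mathbf{c}_1w_1(1-t)^2t+3\mathbf{c}_2w_2(1-t)t^2+\mathbf{c}_3w_3t^3}{w_0(1-t)^3+3w_1(1-t)^2t+3w_2(1-t)t^2+w_3t^3},$$ and $u_i=\binom{3}{i}w_i$. $\lambda_{ijk}=\begin{vmatrix}c_{i,0}&c_{i,1}&1\\c_{j,0}&c_{j,1}&1\\c_{k,0}&c_{k,1}&1\end{vmatrix}$, and $\lambda_0=\lambda_{321}$, $\lambda_1=\lambda_{230}$, $\lambda_2=\lambda_{103}$, $\lambda_3=\lambda_{012}$. The curve degenerates to a conic if it lies on a conic section, i.e. some nonzero polynomial in $x,y$ of total degree at most $2$ vanishes identically on $\mathbf{p}(t)$. *)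

theory Defs
  imports "HOL-Analysis.Analysis"
begin

text \<open>Control points and weights are families indexed by the natural numbers, of which only the
  indices 0, 1, 2, 3 are used. The components \<open>c\<^sub>i\<^sub>,\<^sub>0\<close> and \<open>c\<^sub>i\<^sub>,\<^sub>1\<close> of a control point are
  \<open>c i $ 1\<close> and \<open>c i $ 2\<close>.\<close>

definition bezier_denom :: "(nat \<Rightarrow> real) \<Rightarrow> real \<Rightarrow> real" where
  "bezier_denom w t = (\<Sum>i\<le>3. w i * Bernstein 3 i t)"

definition bezier_curve :: "(nat \<Rightarrow> real ^ 2) \<Rightarrow> (nat \<Rightarrow> real) \<Rightarrow> real \<Rightarrow> real ^ 2" where
  "bezier_curve c w t = (\<Sum>i\<le>3. (w i * Bernstein 3 i t) *\<^sub>R c i) /\<^sub>R bezier_denom w t"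

text \<open>The weights may have different signs, so the denominator can vanish; the curve consists of
  the points at those parameters where it does not (where it does, \<open>bezier_curve\<close> takes the
  meaningless value 0). The six coefficients are those of an arbitrary polynomial in \<open>x\<close>, \<open>y\<close> of
  total degree at most 2.\<close>

definition degenerates_to_conic :: "(nat \<Rightarrow> real ^ 2) \<Rightarrow> (nat \<Rightarrow> real) \<Rightarrow> bool" where
  "degenerates_to_conic c w \<longleftrightarrow>
    (\<exists>a\<^sub>2\<^sub>0 a\<^sub>1\<^sub>1 a\<^sub>0\<^sub>2 a\<^sub>1\<^sub>0 a\<^sub>0\<^sub>1 a\<^sub>0\<^sub>0 :: real.
      (a\<^sub>2\<^sub>0, a\<^sub>1\<^sub>1, a\<^sub>0\<^sub>2, a\<^sub>1\<^sub>0, a\<^sub>0\<^sub>1, a\<^sub>0\<^sub>0) \<noteq> (0, 0, 0, 0, 0, 0) \<and>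
      (\<forall>t. bezier_denom w t \<noteq> 0 \<longrightarrow>
        (let x = bezier_curve c w t $ 1; y = bezier_curve c w t $ 2
         in a\<^sub>2\<^sub>0 * x\<^sup>2 + a\<^sub>1\<^sub>1 * x * y + a\<^sub>0\<^sub>2 * y\<^sup>2 + a\<^sub>1\<^sub>0 * x + a\<^sub>0\<^sub>1 * y + a\<^sub>0\<^sub>0 = 0)))"

definition u_coeff :: "(nat \<Rightarrow> real) \<Rightarrow> nat \<Rightarrow> real" where
  "u_coeff w i = real (3 choose i) * w i"

definition lambda_det :: "(nat \<Rightarrow> real ^ 2) \<Rightarrow> nat \<Rightarrow> nat \<Rightarrow> nat \<Rightarrow> real" where
  "lambda_det c i j k =
    det (vector [vector [c i $ 1, c i $ 2, 1],
                 vector [c j $ 1, c j $ 2, 1],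
                 vector [c k $ 1, c k $ 2, 1]] :: real ^ 3 ^ 3)"

definition lambda0 :: "(nat \<Rightarrow> real ^ 2) \<Rightarrow> real" where
  "lambda0 c = lambda_det c 3 2 1"

definition lambda1 :: "(nat \<Rightarrow> real ^ 2) \<Rightarrow> real" where
  "lambda1 c = lambda_det c 2 3 0"

definition lambda2 :: "(nat \<Rightarrow> real ^ 2) \<Rightarrow> real" where
  "lambda2 c = lambda_det c 1 0 3"

definition lambda3 :: "(nat \<Rightarrow> real ^ 2) \<Rightarrow> real" where
  "lambda3 c = lambda_det c 0 1 2"

definition phi1 :: "(nat \<Rightarrow> real ^ 2) \<Rightarrow> (nat \<Rightarrow> real) \<Rightarrow> real" where
  "phi1 c w = u_coeff w 0 * u_coeff w 2 * (lambda1 c)\<^sup>2 - (u_coeff w 1)\<^sup>2 * lambda0 c * lambda2 c"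

definition phi2 :: "(nat \<Rightarrow> real ^ 2) \<Rightarrow> (nat \<Rightarrow> real) \<Rightarrow> real" where
  "phi2 c w = u_coeff w 1 * u_coeff w 3 * (lambda2 c)\<^sup>2 - (u_coeff w 2)\<^sup>2 * lambda1 c * lambda3 c"

end

theory Submission
  imports Defs
begin

text \<open>Lift the control points to homogeneous vectors \<open>C\<^sub>i = (c\<^sub>i, 1)\<close> of \<open>\<real>\<^sup>3\<close>. The curve becomes
\<open>P(t) = \<Sum>\<^sub>i u\<^sub>i t\<^sup>i (1-t)\<^sup>3\<^sup>-\<^sup>i C\<^sub>i\<close>, and a conic becomes a quadratic form with a symmetric polar form
\<open>\<beta>\<close>. Four vectors in \<open>\<real>\<^sup>3\<close> are dependent, and Cramer's rule says how:
\<open>\<lambda>\<^sub>0 C\<^sub>0 + \<lambda>\<^sub>1 C\<^sub>1 + \<lambda>\<^sub>2 C\<^sub>2 + \<lambda>\<^sub>3 C\<^sub>3 = 0\<close> (\<open>lambda_syzygy\<close>), where no \<open>\<lambda>\<^sub>i\<close> vanishes because no three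
control points are collinear.

Suppose that the curve lies on a conic, and put \<open>b\<^sub>i\<^sub>j = \<beta>(C\<^sub>i, C\<^sub>j)\<close>. Then \<open>\<beta>(P(t), P(t))\<close> is a form of
degree 6 in \<open>t\<close> and \<open>1-t\<close> with infinitely many zeros, so its seven coefficients vanish
(\<open>bezier_quadratic_coeffs_zero\<close>). Four of them say \<open>b\<^sub>0\<^sub>0 = b\<^sub>0\<^sub>1 = b\<^sub>2\<^sub>3 = b\<^sub>3\<^sub>3 = 0\<close>. Pairing the syzygy
with \<open>C\<^sub>0\<close> and \<open>C\<^sub>3\<close> and using the other three coefficients expresses every remaining \<open>b\<^sub>i\<^sub>j\<close> as a
multiple of \<open>k = b\<^sub>0\<^sub>3\<close>, so \<open>k \<noteq> 0\<close>, as otherwise \<open>\<beta> = 0\<close>. Pairing the syzygy with \<open>C\<^sub>1\<close> and \<open>C\<^sub>2\<close> then leaves two equations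
\<open>2X - XY = 1\<close> and \<open>2Y - XY = 1\<close> for the ratios \<open>X\<close> and \<open>Y\<close> of the two terms of \<open>\<phi>\<^sub>1\<close> and of \<open>\<phi>\<^sub>2\<close>.
Their only solution is \<open>X = Y = 1\<close>, that is, \<open>\<phi>\<^sub>1 = \<phi>\<^sub>2 = 0\<close>.

Conversely, the conic is known in advance. It must be tangent to \<open>c\<^sub>0c\<^sub>1\<close> at \<open>c\<^sub>0\<close> and to \<open>c\<^sub>2c\<^sub>3\<close> at
\<open>c\<^sub>3\<close>, hence belongs to the pencil spanned by the line pair \<open>c\<^sub>0c\<^sub>1\<close>, \<open>c\<^sub>2c\<^sub>3\<close> and the double line
\<open>c\<^sub>0c\<^sub>3\<close>. If \<open>\<phi>\<^sub>1 = \<phi>\<^sub>2 = 0\<close>, the member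
\<open>\<lambda>\<^sub>1 \<lambda>\<^sub>2 [p, c\<^sub>0, c\<^sub>1] [p, c\<^sub>2, c\<^sub>3] = \<lambda>\<^sub>0 \<lambda>\<^sub>3 [p, c\<^sub>0, c\<^sub>3]\<^sup>2\<close> contains the curve (\<open>degenerates_if_phi_zero\<close>),
where \<open>[p, q, r]\<close> is the determinant of the lifted points.\<close>

section \<open>Orientation determinants and affine functionals\<close>

text \<open>The determinant with rows \<open>(p, 1)\<close>, \<open>(q, 1)\<close>, \<open>(r, 1)\<close>, that is, twice the signed area of the
triangle, expanded along the first row to exhibit it as affine in \<open>p\<close>.\<close>

definition orient :: "real ^ 2 \<Rightarrow> real ^ 2 \<Rightarrow> real ^ 2 \<Rightarrow> real" where
  "orient p q r = p $ 1 * (q $ 2 - r $ 2) - p $ 2 * (q $ 1 - r $ 1) + (q $ 1 * r $ 2 - q $ 2 * r $ 1)"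

definition affine_functional :: "(real ^ 2 \<Rightarrow> real) \<Rightarrow> bool" where
  "affine_functional f \<longleftrightarrow> (\<exists>A B C. \<forall>p. f p = A * p $ 1 + B * p $ 2 + C)"

lemma affine_functionalE:
  assumes "affine_functional f"
  obtains A B C where "\<And>p. f p = A * p $ 1 + B * p $ 2 + C"
  using assms unfolding affine_functional_def by blast

lemma lambda_det_eq_orient: "lambda_det c i j k = orient (c i) (c j) (c k)"
  by (simp add: lambda_det_def orient_def det_3 algebra_simps)

lemma lambdas_eq_orient:
  "lambda0 c = - orient (c 1) (c 2) (c 3)" "lambda1 c = orient (c 0) (c 2) (c 3)"
  "lambda2 c = - orient (c 0) (c 1) (c 3)" "lambda3 c = orient (c 0) (c 1) (c 2)"
  by (simp_all add: lambda0_def lambda1_def lambda2_def lambda3_def lambda_det_eq_orient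
      orient_def algebra_simps)

lemma orient_zero_imp_collinear:
  assumes "orient p q r = 0"
  shows "collinear {p, q, r}"
proof (cases "q = p")
  case False
  have dep: "(r $ 1 - p $ 1) * (q $ 2 - p $ 2) = (r $ 2 - p $ 2) * (q $ 1 - p $ 1)"
    using assms by (simp add: orient_def algebra_simps)
  from False consider "q $ 1 - p $ 1 \<noteq> 0" | "q $ 2 - p $ 2 \<noteq> 0"
    by (auto simp: vec_eq_iff forall_2)
  then have "\<exists>d. r - p = d *\<^sub>R (q - p)"
  proof cases
    case 1
    with dep have "r - p = ((r $ 1 - p $ 1) / (q $ 1 - p $ 1)) *\<^sub>R (q - p)"
      by (simp add: vec_eq_iff forall_2)
    then show ?thesis by blast
  next
    case 2
    with dep have "r - p = ((r $ 2 - p $ 2) / (q $ 2 - p $ 2)) *\<^sub>R (q - p)"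
      by (simp add: vec_eq_iff forall_2 nonzero_eq_divide_eq)
    then show ?thesis by blast
  qed
  then have "collinear {0, q - p, r - p}"
    by (simp add: collinear_lemma)
  then have "collinear {q, p, r}"
    by (simp add: collinear_3)
  then show ?thesis by (simp add: insert_commute)
qed simp

lemma affine_functional_orient: "affine_functional (\<lambda>p. orient p q r)"
  unfolding affine_functional_def orient_def
  by (rule exI[of _ "q $ 2 - r $ 2"], rule exI[of _ "r $ 1 - q $ 1"],
      rule exI[of _ "q $ 1 * r $ 2 - q $ 2 * r $ 1"]) (simp add: algebra_simps)

text \<open>Barycentric interpolation, by Cramer's rule, cleared of its denominator so that it also holds for
a degenerate triangle.\<close>

lemma affine_functional_barycentric:
  assumes "affine_functional f"
  shows "orient a b c * f p = orient p b c * f a + orient a p c * f b + orient a b p * f c"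
proof -
  from assms obtain A B C where f: "\<And>p. f p = A * p $ 1 + B * p $ 2 + C"
    by (metis affine_functionalE)
  show ?thesis
    unfolding f orient_def by (simp add: algebra_simps)
qed

text \<open>The dependency \<open>\<Sum>\<^sub>i \<lambda>\<^sub>i C\<^sub>i = 0\<close> of the lifted control points, tested against an arbitrary linear
functional of \<open>\<real>\<^sup>3\<close>; these restrict to the affine functionals of the plane.\<close>

lemma lambda_syzygy:
  assumes "affine_functional f"
  shows "lambda0 c * f (c 0) + lambda1 c * f (c 1) + lambda2 c * f (c 2) + lambda3 c * f (c 3) = 0"
  using affine_functional_barycentric[OF assms, of "c 0" "c 1" "c 2" "c 3"]
  by (simp add: lambdas_eq_orient orient_def algebra_simps)

text \<open>A triangle affinely spans the plane, so a symmetric biaffine form is determined by its values at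
the vertices.\<close>

lemma biaffine_zero:
  assumes sym: "\<And>p q. \<beta> p q = \<beta> q p" and aff: "\<And>q. affine_functional (\<lambda>p. \<beta> p q)"
    and indep: "orient x y z \<noteq> 0"
    and zero: "\<And>p q. p \<in> {x, y, z} \<Longrightarrow> q \<in> {x, y, z} \<Longrightarrow> \<beta> p q = 0"
  shows "\<beta> p q = 0"
proof -
  have ext: "\<beta> p q = 0" if "\<And>r. r \<in> {x, y, z} \<Longrightarrow> \<beta> r q = 0" for p q
    using affine_functional_barycentric[OF aff, of x y z p q] indep that by simp
  have "\<beta> p q = 0" if "q \<in> {x, y, z}" for p q
    using ext zero that by blast
  then show ?thesis
    using ext sym by metis
qed

section \<open>The curve in homogeneous form\<close>

lemma bezier_weight: "w i * Bernstein 3 i t = u_coeff w i * t ^ i * (1 - t) ^ (3 - i)"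
  by (simp add: u_coeff_def Bernstein_def)

lemma bezier_denom_expand:
  "bezier_denom w t = (\<Sum>i\<le>3. u_coeff w i * t ^ i * (1 - t) ^ (3 - i))"
  by (simp add: bezier_denom_def bezier_weight)

text \<open>Where the denominator is nonzero, the curve point is an affine combination of the control points;
multiplying by the denominator makes the right-hand side a form in \<open>t\<close> and \<open>1 - t\<close>.\<close>

lemma affine_functional_bezier:
  assumes "affine_functional f" "bezier_denom w t \<noteq> 0"
  shows "bezier_denom w t * f (bezier_curve c w t)
       = (\<Sum>i\<le>3. u_coeff w i * t ^ i * (1 - t) ^ (3 - i) * f (c i))"
proof -
  from assms obtain A B C where f: "\<And>p. f p = A * p $ 1 + B * p $ 2 + C"
    by (metis affine_functionalE)
  have coord: "bezier_denom w t * bezier_curve c w t $ j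
      = (\<Sum>i\<le>3. u_coeff w i * t ^ i * (1 - t) ^ (3 - i) * c i $ j)" for j
    using assms(2) by (simp add: bezier_curve_def bezier_weight)
  have "bezier_denom w t * f (bezier_curve c w t)
      = A * (bezier_denom w t * bezier_curve c w t $ 1)
        + B * (bezier_denom w t * bezier_curve c w t $ 2) + C * bezier_denom w t"
    by (simp add: f algebra_simps)
  also have "\<dots> = (\<Sum>i\<le>3. u_coeff w i * t ^ i * (1 - t) ^ (3 - i) * f (c i))"
    unfolding coord unfolding bezier_denom_expand
    by (simp add: f sum_distrib_left sum.distrib algebra_simps)
  finally show ?thesis .
qed

text \<open>Dividing by \<open>(1-t)\<^sup>n\<close> turns the form into a polynomial in \<open>x = t/(1-t)\<close>. This substitution is
injective away from \<open>t = 1\<close>, so the polynomial has infinitely many roots.\<close>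

lemma Bernstein_form_zero_imp_coeffs_zero:
  fixes g :: "nat \<Rightarrow> real"
  assumes "infinite {t. (\<Sum>k\<le>n. g k * t ^ k * (1 - t) ^ (n - k)) = 0}" "k \<le> n"
  shows "g k = 0"
proof -
  define Z where "Z = {t. (\<Sum>k\<le>n. g k * t ^ k * (1 - t) ^ (n - k)) = 0} - {1}"
  have "inj_on (\<lambda>t. t / (1 - t)) Z"
    by (auto simp: inj_on_def Z_def field_simps)
  moreover have "infinite Z"
    using assms(1) by (simp add: Z_def)
  moreover have "(\<lambda>t. t / (1 - t)) ` Z \<subseteq> {x. (\<Sum>k\<le>n. g k * x ^ k) = 0}"
  proof clarsimp
    fix t assume "t \<in> Z"
    then have t: "1 - t \<noteq> 0" "(\<Sum>k\<le>n. g k * t ^ k * (1 - t) ^ (n - k)) = 0"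
      by (auto simp: Z_def)
    have "(1 - t) ^ n * (\<Sum>k\<le>n. g k * (t / (1 - t)) ^ k)
        = (\<Sum>k\<le>n. g k * t ^ k * (1 - t) ^ (n - k))"
      unfolding sum_distrib_left using t(1)
      by (intro sum.cong) (auto simp: power_diff power_divide)
    with t show "(\<Sum>k\<le>n. g k * (t / (1 - t)) ^ k) = 0"
      by simp
  qed
  ultimately have "infinite {x. (\<Sum>k\<le>n. g k * x ^ k) = 0}"
    using finite_imageD finite_subset by blast
  then show ?thesis
    using assms(2) polyfun_finite_roots by blast
qed

lemma infinite_bezier_denom_nonzero:
  assumes "w 0 \<noteq> 0"
  shows "infinite {t. bezier_denom w t \<noteq> 0}"
proof
  assume "finite {t. bezier_denom w t \<noteq> 0}"
  moreover have "{t. bezier_denom w t = 0} = - {t. bezier_denom w t \<noteq> 0}"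
    by auto
  ultimately have "infinite {t. bezier_denom w t = 0}"
    by (metis finite_compl infinite_UNIV_char_0)
  then have "u_coeff w 0 = 0"
    unfolding bezier_denom_expand by (rule Bernstein_form_zero_imp_coeffs_zero) simp
  with assms show False
    by (simp add: u_coeff_def)
qed

section \<open>A curve on a conic satisfies the two equations\<close>

text \<open>The conclusions are the coefficients of \<open>\<beta>(P(t), P(t)) = \<Sum>\<^sub>i\<^sub>,\<^sub>j u\<^sub>i u\<^sub>j b\<^sub>i\<^sub>j t\<^sup>i\<^sup>+\<^sup>j (1-t)\<^sup>6\<^sup>-\<^sup>i\<^sup>-\<^sup>j\<close>, up to
factors 2.\<close>

lemma bezier_quadratic_coeffs_zero:
  assumes sym: "\<And>p q. \<beta> p q = \<beta> q p" and aff: "\<And>q. affine_functional (\<lambda>p. \<beta> p q)"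
    and w: "w 0 \<noteq> 0"
    and zero: "\<And>t. bezier_denom w t \<noteq> 0 \<Longrightarrow> \<beta> (bezier_curve c w t) (bezier_curve c w t) = 0"
  defines "u \<equiv> u_coeff w" and "b \<equiv> \<lambda>i j. \<beta> (c i) (c j)"
  shows "(u 0)\<^sup>2 * b 0 0 = 0" "u 0 * u 1 * b 0 1 = 0"
    "2 * u 0 * u 2 * b 0 2 + (u 1)\<^sup>2 * b 1 1 = 0"
    "u 0 * u 3 * b 0 3 + u 1 * u 2 * b 1 2 = 0"
    "2 * u 1 * u 3 * b 1 3 + (u 2)\<^sup>2 * b 2 2 = 0"
    "u 2 * u 3 * b 2 3 = 0" "(u 3)\<^sup>2 * b 3 3 = 0"
proof -
  define g where "g = (\<lambda>k. [(u 0)\<^sup>2 * b 0 0, 2 * u 0 * u 1 * b 0 1,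
     2 * u 0 * u 2 * b 0 2 + (u 1)\<^sup>2 * b 1 1,
     2 * (u 0 * u 3 * b 0 3 + u 1 * u 2 * b 1 2),
     2 * u 1 * u 3 * b 1 3 + (u 2)\<^sup>2 * b 2 2,
     2 * u 2 * u 3 * b 2 3, (u 3)\<^sup>2 * b 3 3] ! k)"
  have bsym: "b i j = b j i" for i j
    unfolding b_def by (rule sym)
  have "(\<Sum>k\<le>6. g k * t ^ k * (1 - t) ^ (6 - k)) = 0" if t: "bezier_denom w t \<noteq> 0" for t
  proof -
    define P where "P = bezier_curve c w t"
    define m where "m = (\<lambda>i. u i * t ^ i * (1 - t) ^ (3 - i))"
    have expand: "bezier_denom w t * \<beta> P q = (\<Sum>i\<le>3. m i * \<beta> (c i) q)" for q
      using affine_functional_bezier[OF aff t] by (simp add: P_def m_def u_def)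
    have "0 = bezier_denom w t * (bezier_denom w t * \<beta> P P)"
      using zero[OF t] by (simp add: P_def)
    also have "\<dots> = (\<Sum>i\<le>3. m i * (bezier_denom w t * \<beta> P (c i)))"
      unfolding expand[of P] sum_distrib_left by (subst sym) (simp add: mult_ac)
    also have "\<dots> = (\<Sum>i\<le>3. \<Sum>j\<le>3. m i * m j * b j i)"
      unfolding expand by (simp add: sum_distrib_left b_def mult_ac)
    also have "\<dots> = (\<Sum>k\<le>6. g k * t ^ k * (1 - t) ^ (6 - k))"
      unfolding g_def m_def
      using bsym[of 1 0] bsym[of 2 0] bsym[of 3 0] bsym[of 2 1] bsym[of 3 1] bsym[of 3 2]
      by (simp add: eval_nat_numeral algebra_simps)
    finally show ?thesis by simp
  qed
  then have "{t. bezier_denom w t \<noteq> 0} \<subseteq> {t. (\<Sum>k\<le>6. g k * t ^ k * (1 - t) ^ (6 - k)) = 0}"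
    by auto
  with infinite_bezier_denom_nonzero[of w, OF w]
  have "infinite {t. (\<Sum>k\<le>6. g k * t ^ k * (1 - t) ^ (6 - k)) = 0}"
    using finite_subset by blast
  then have "g k = 0" if "k \<le> 6" for k
    using Bernstein_form_zero_imp_coeffs_zero that by blast
  from this[of 0] this[of 1] this[of 2] this[of 3] this[of 4] this[of 5] this[of 6]
  show "(u 0)\<^sup>2 * b 0 0 = 0" "u 0 * u 1 * b 0 1 = 0"
    "2 * u 0 * u 2 * b 0 2 + (u 1)\<^sup>2 * b 1 1 = 0"
    "u 0 * u 3 * b 0 3 + u 1 * u 2 * b 1 2 = 0"
    "2 * u 1 * u 3 * b 1 3 + (u 2)\<^sup>2 * b 2 2 = 0"
    "u 2 * u 3 * b 2 3 = 0" "(u 3)\<^sup>2 * b 3 3 = 0"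
    by (simp_all add: g_def)
qed

text \<open>Subtracting the equations gives \<open>X = Y\<close>, and each of them then reads \<open>(X - 1)\<^sup>2 = 0\<close>.\<close>

lemma double_minus_product_eq_1_unique:
  fixes X Y :: real
  assumes "2 * X - X * Y = 1" "2 * Y - X * Y = 1"
  shows "X = 1" "Y = 1"
proof -
  have "X = Y" using assms by simp
  with assms(1) have "(X - 1)\<^sup>2 = 0"
    by (simp add: power2_eq_square algebra_simps)
  with \<open>X = Y\<close> show "X = 1" "Y = 1" by simp_all
qed

text \<open>Up to the scalar \<open>k\<close>, the rows of the syzygy at \<open>c\<^sub>0\<close> and \<open>c\<^sub>3\<close> and the vanishing coefficients
determine the whole matrix \<open>b\<^sub>i\<^sub>j\<close>. The rows at \<open>c\<^sub>1\<close> and \<open>c\<^sub>2\<close> are then the compatibility conditions,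
and they are the two equations.\<close>

lemma phi_zero_if_biaffine_form_vanishes:
  assumes sym: "\<And>p q. \<beta> p q = \<beta> q p" and aff: "\<And>q. affine_functional (\<lambda>p. \<beta> p q)"
    and w: "\<And>i. i \<le> 3 \<Longrightarrow> w i \<noteq> 0"
    and l: "lambda0 c \<noteq> 0" "lambda1 c \<noteq> 0" "lambda2 c \<noteq> 0" "lambda3 c \<noteq> 0"
    and zero: "\<And>t. bezier_denom w t \<noteq> 0 \<Longrightarrow> \<beta> (bezier_curve c w t) (bezier_curve c w t) = 0"
    and nz: "\<beta> p q \<noteq> 0"
  shows "phi1 c w = 0" "phi2 c w = 0"
proof -
  note [simp del] = One_nat_def
  define u where "u = u_coeff w"
  define b where "b = (\<lambda>i j. \<beta> (c i) (c j))"
  define l0 l1 l2 l3 where l_def: "l0 = lambda0 c" "l1 = lambda1 c" "l2 = lambda2 c" "l3 = lambda3 c"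
  note l = l[folded l_def]
  have u: "u 0 \<noteq> 0" "u 1 \<noteq> 0" "u 2 \<noteq> 0" "u 3 \<noteq> 0"
    using w by (simp_all add: u_def u_coeff_def)
  have bsym: "b i j = b j i" for i j
    unfolding b_def by (rule sym)
  have b_app: "b i j = \<beta> (c i) (c j)" for i j
    by (simp add: b_def)
  note coeffs = bezier_quadratic_coeffs_zero[where \<beta> = \<beta> and c = c and w = w,
      OF sym aff w[of 0, simplified] zero, folded u_def b_app]
  have b0: "b 0 0 = 0" "b 0 1 = 0" "b 2 3 = 0" "b 3 3 = 0"
    using coeffs u by simp_all
  have row: "l0 * b i 0 + l1 * b i 1 + l2 * b i 2 + l3 * b i 3 = 0" for i
    using lambda_syzygy[OF aff, of c "c i"] by (simp add: b_def l_def sym[of "c i"])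
  define k where "k = b 0 3"
  have b02: "b 0 2 = - l3 * k / l2"
    using row[of 0] b0 l by (simp add: k_def field_simps)
  have b13: "b 1 3 = - l0 * k / l1"
    using row[of 3] b0 l bsym[of 3 0] bsym[of 3 1] bsym[of 3 2] by (simp add: k_def field_simps)
  have b12: "b 1 2 = - u 0 * u 3 * k / (u 1 * u 2)"
    using coeffs(4) u by (simp add: k_def field_simps)
  have b11: "b 1 1 = 2 * u 0 * u 2 * l3 * k / (l2 * (u 1)\<^sup>2)"
    using coeffs(3) u l by (simp add: b02 field_simps)
  have b22: "b 2 2 = 2 * u 1 * u 3 * l0 * k / (l1 * (u 2)\<^sup>2)"
    using coeffs(5) u l by (simp add: b13 field_simps)
  \<comment> \<open>For \<open>k = 0\<close> the form would vanish on the triangle \<open>c\<^sub>0\<close>, \<open>c\<^sub>1\<close>, \<open>c\<^sub>2\<close>, hence everywhere.\<close>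
  have k: "k \<noteq> 0"
  proof
    assume "k = 0"
    then have "b i j = 0" if "i \<in> {0, 1, 2}" "j \<in> {0, 1, 2}" for i j
      using that b0 b02 b12 b11 b22 bsym[of 1 0] bsym[of 2 0] bsym[of 2 1] by auto
    then have "\<beta> r s = 0" if "r \<in> {c 0, c 1, c 2}" "s \<in> {c 0, c 1, c 2}" for r s
      using that by (auto simp: b_def)
    moreover have "orient (c 0) (c 1) (c 2) \<noteq> 0"
      using l(4) by (simp add: l_def lambdas_eq_orient)
    ultimately have "\<beta> p q = 0"
      using biaffine_zero[of \<beta>, OF sym aff] by blast
    with nz show False by simp
  qed
  define X where "X = u 0 * u 2 * l1\<^sup>2 / ((u 1)\<^sup>2 * l0 * l2)"
  define Y where "Y = u 1 * u 3 * l2\<^sup>2 / ((u 2)\<^sup>2 * l1 * l3)"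
  \<comment> \<open>Dividing the syzygy rows at \<open>c\<^sub>1\<close> and \<open>c\<^sub>2\<close> by the common factors below, their middle
    terms become \<open>- X Y\<close>, because \<open>X Y = u\<^sub>0 u\<^sub>3 \<lambda>\<^sub>1 \<lambda>\<^sub>2 / (u\<^sub>1 u\<^sub>2 \<lambda>\<^sub>0 \<lambda>\<^sub>3)\<close>.\<close>
  have "l0 * l3 * k / l1 * (2 * X - X * Y - 1) = l0 * b 1 0 + l1 * b 1 1 + l2 * b 1 2 + l3 * b 1 3"
    using u l b0 bsym[of 1 0]
    by (simp add: X_def Y_def b11 b12 b13 field_simps power2_eq_square)
  then have "2 * X - X * Y = 1"
    using row[of 1] l k by simp
  moreover have "l0 * l3 * k / l2 * (2 * Y - X * Y - 1)
      = l0 * b 2 0 + l1 * b 2 1 + l2 * b 2 2 + l3 * b 2 3"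
    using u l b0
    by (simp add: X_def Y_def bsym[of 2 0] bsym[of 2 1] b02 b12 b22 field_simps power2_eq_square)
  then have "2 * Y - X * Y = 1"
    using row[of 2] l k by simp
  ultimately have "X = 1" "Y = 1"
    by (rule double_minus_product_eq_1_unique)+
  then show "phi1 c w = 0" "phi2 c w = 0"
    using u l by (simp_all add: phi1_def phi2_def X_def Y_def flip: u_def l_def)
qed

text \<open>A quadratic polynomial is the diagonal of its polar form, in which each linear term is split evenly
between the two arguments; the six coefficients can be read off from values of the polar form.\<close>

lemma phi_zero_if_degenerates:
  assumes "degenerates_to_conic c w"
    and w: "\<And>i. i \<le> 3 \<Longrightarrow> w i \<noteq> 0"
    and l: "lambda0 c \<noteq> 0" "lambda1 c \<noteq> 0" "lambda2 c \<noteq> 0" "lambda3 c \<noteq> 0"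
  shows "phi1 c w = 0 \<and> phi2 c w = 0"
proof -
  from assms(1) obtain A B C D E F :: real where nz: "(A, B, C, D, E, F) \<noteq> (0, 0, 0, 0, 0, 0)"
    and conic: "\<And>t x y. bezier_denom w t \<noteq> 0 \<Longrightarrow> x = bezier_curve c w t $ 1 \<Longrightarrow>
      y = bezier_curve c w t $ 2 \<Longrightarrow> A * x\<^sup>2 + B * x * y + C * y\<^sup>2 + D * x + E * y + F = 0"
    unfolding degenerates_to_conic_def Let_def by blast
  define \<beta> :: "real ^ 2 \<Rightarrow> real ^ 2 \<Rightarrow> real" where
    "\<beta> = (\<lambda>p q. A * p $ 1 * q $ 1 + B * (p $ 1 * q $ 2 + p $ 2 * q $ 1) / 2 + C * p $ 2 * q $ 2
       + D * (p $ 1 + q $ 1) / 2 + E * (p $ 2 + q $ 2) / 2 + F)"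
  have sym: "\<beta> p q = \<beta> q p" for p q
    by (simp add: \<beta>_def algebra_simps)
  have aff: "affine_functional (\<lambda>p. \<beta> p q)" for q
    unfolding affine_functional_def \<beta>_def
    by (rule exI[of _ "A * q $ 1 + B * q $ 2 / 2 + D / 2"],
        rule exI[of _ "B * q $ 1 / 2 + C * q $ 2 + E / 2"],
        rule exI[of _ "D * q $ 1 / 2 + E * q $ 2 / 2 + F"]) (simp add: field_simps)
  have zero: "\<beta> (bezier_curve c w t) (bezier_curve c w t) = 0" if "bezier_denom w t \<noteq> 0" for t
    using conic[OF that refl refl] by (simp add: \<beta>_def power2_eq_square algebra_simps)
  have "\<exists>p q. \<beta> p q \<noteq> 0"
  proof (rule ccontr)
    assume "\<not> ?thesis"
    then have all: "\<beta> (vector [x, y]) (vector [x', y']) = 0" for x y x' y'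
      by blast
    have "F = 0" using all[of 0 0 0 0] by (simp add: \<beta>_def)
    moreover have "D = 0" using all[of 1 0 0 0] \<open>F = 0\<close> by (simp add: \<beta>_def)
    moreover have "E = 0" using all[of 0 1 0 0] \<open>F = 0\<close> by (simp add: \<beta>_def)
    ultimately show False
      using all[of 1 0 1 0] all[of 0 1 0 1] all[of 1 0 0 1] nz by (simp add: \<beta>_def)
  qed
  then obtain p q where "\<beta> p q \<noteq> 0" by blast
  then show ?thesis
    using phi_zero_if_biaffine_form_vanishes[of \<beta>, OF sym aff w l zero] by blast
qed

section \<open>The conic through a curve that satisfies the equations\<close>

text \<open>A member of the pencil spanned by the line pair \<open>f g = 0\<close> and the double line \<open>h\<^sup>2 = 0\<close>. A point
where it does not vanish shows that its six coefficients are not all zero.\<close>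

lemma degenerates_if_on_pencil_member:
  assumes "affine_functional f" "affine_functional g" "affine_functional h"
    and nz: "r * f p * g p - s * (h p)\<^sup>2 \<noteq> 0"
    and zero: "\<And>t P. bezier_denom w t \<noteq> 0 \<Longrightarrow> P = bezier_curve c w t \<Longrightarrow>
      r * f P * g P - s * (h P)\<^sup>2 = 0"
  shows "degenerates_to_conic c w"
proof -
  from assms(1-3) obtain f1 f2 f3 g1 g2 g3 h1 h2 h3
    where f: "\<And>p. f p = f1 * p $ 1 + f2 * p $ 2 + f3"
      and g: "\<And>p. g p = g1 * p $ 1 + g2 * p $ 2 + g3"
      and h: "\<And>p. h p = h1 * p $ 1 + h2 * p $ 2 + h3"
    by (metis affine_functionalE)
  define A B C D E F where coeffs: "A = r * f1 * g1 - s * h1\<^sup>2"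
    "B = r * (f1 * g2 + f2 * g1) - 2 * s * h1 * h2" "C = r * f2 * g2 - s * h2\<^sup>2"
    "D = r * (f1 * g3 + f3 * g1) - 2 * s * h1 * h3"
    "E = r * (f2 * g3 + f3 * g2) - 2 * s * h2 * h3" "F = r * f3 * g3 - s * h3\<^sup>2"
  have expand: "r * f P * g P - s * (h P)\<^sup>2
      = A * (P $ 1)\<^sup>2 + B * P $ 1 * P $ 2 + C * (P $ 2)\<^sup>2 + D * P $ 1 + E * P $ 2 + F" for P
    unfolding f g h coeffs by (simp add: power2_eq_square algebra_simps)
  have "(A, B, C, D, E, F) \<noteq> (0, 0, 0, 0, 0, 0)"
    using nz unfolding expand by auto
  with zero show ?thesis
    unfolding degenerates_to_conic_def Let_def expand by blast
qed

lemma sum_atMost_3: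
  fixes e :: "nat \<Rightarrow> 'a::comm_monoid_add"
  shows "(\<Sum>i\<le>3. e i) = e 0 + e 1 + e 2 + e 3"
  by (simp add: eval_nat_numeral)

text \<open>In a pencil member \<open>r [p, c\<^sub>0, c\<^sub>1] [p, c\<^sub>2, c\<^sub>3] = s [p, c\<^sub>0, c\<^sub>3]\<^sup>2\<close> that contains the curve, the lowest
coefficient in \<open>t\<close> forces \<open>s / r = u\<^sub>0 u\<^sub>2 \<lambda>\<^sub>1 \<lambda>\<^sub>3 / (u\<^sub>1\<^sup>2 \<lambda>\<^sub>2\<^sup>2)\<close>, and \<open>\<phi>\<^sub>1 = 0\<close> makes this
\<open>\<lambda>\<^sub>0 \<lambda>\<^sub>3 / (\<lambda>\<^sub>1 \<lambda>\<^sub>2)\<close>; this is where the chosen conic comes from.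

Substituting the curve into the conic leaves, after the factor \<open>t\<^sup>2 (1-t)\<^sup>2\<close>, a binary quadratic form.
Its outer coefficients are multiples of \<open>\<phi>\<^sub>1\<close> and \<open>\<phi>\<^sub>2\<close>. The middle one is a multiple of
\<open>u\<^sub>0 u\<^sub>3 \<lambda>\<^sub>1 \<lambda>\<^sub>2 - u\<^sub>1 u\<^sub>2 \<lambda>\<^sub>0 \<lambda>\<^sub>3\<close>, which vanishes as well: multiply the equations \<open>\<phi>\<^sub>1 = 0\<close> and
\<open>\<phi>\<^sub>2 = 0\<close> and cancel.\<close>

lemma degenerates_if_phi_zero:
  assumes phi: "phi1 c w = 0" "phi2 c w = 0"
    and w: "\<And>i. i \<le> 3 \<Longrightarrow> w i \<noteq> 0"
    and l: "lambda0 c \<noteq> 0" "lambda1 c \<noteq> 0" "lambda2 c \<noteq> 0" "lambda3 c \<noteq> 0"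
  shows "degenerates_to_conic c w"
proof -
  note [simp del] = One_nat_def
  define u where "u = u_coeff w"
  define l0 l1 l2 l3 where l_def: "l0 = lambda0 c" "l1 = lambda1 c" "l2 = lambda2 c" "l3 = lambda3 c"
  note l = l[folded l_def]
  have u: "u 0 \<noteq> 0" "u 1 \<noteq> 0" "u 2 \<noteq> 0" "u 3 \<noteq> 0"
    using w by (simp_all add: u_def u_coeff_def)
  have p1: "u 0 * u 2 * l1\<^sup>2 = (u 1)\<^sup>2 * l0 * l2" and p2: "u 1 * u 3 * l2\<^sup>2 = (u 2)\<^sup>2 * l1 * l3"
    using phi by (simp_all add: phi1_def phi2_def u_def l_def)
  have p3: "u 0 * u 3 * l1 * l2 = u 1 * u 2 * l0 * l3"
  proof -
    have "(u 1 * u 2 * l1 * l2) * (u 0 * u 3 * l1 * l2) = (u 0 * u 2 * l1\<^sup>2) * (u 1 * u 3 * l2\<^sup>2)"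
      by (simp add: power2_eq_square)
    also have "\<dots> = (u 1 * u 2 * l1 * l2) * (u 1 * u 2 * l0 * l3)"
      unfolding p1 p2 by (simp add: power2_eq_square)
    finally show ?thesis
      using u l by simp
  qed
  define f g h where "f = (\<lambda>p. orient p (c 0) (c 1))" "g = (\<lambda>p. orient p (c 2) (c 3))"
    "h = (\<lambda>p. orient p (c 0) (c 3))"
  note fgh = this
  have aff: "affine_functional f" "affine_functional g" "affine_functional h"
    unfolding fgh by (rule affine_functional_orient)+
  have vals: "f (c 0) = 0" "f (c 1) = 0" "f (c 2) = l3" "f (c 3) = - l2"
    "g (c 0) = l1" "g (c 1) = - l0" "g (c 2) = 0" "g (c 3) = 0"
    "h (c 0) = 0" "h (c 1) = l2" "h (c 2) = - l1" "h (c 3) = 0"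
    by (simp_all add: fgh l_def lambdas_eq_orient orient_def algebra_simps)
  show ?thesis
  proof (rule degenerates_if_on_pencil_member[OF aff, of "l1 * l2" "c 1" "l0 * l3"])
    show "l1 * l2 * f (c 1) * g (c 1) - l0 * l3 * (h (c 1))\<^sup>2 \<noteq> 0"
      using l by (simp add: vals)
  next
    fix t P assume t: "bezier_denom w t \<noteq> 0" and P: "P = bezier_curve c w t"
    define D where "D = bezier_denom w t"
    define s where "s = 1 - t"
    note curve = affine_functional_bezier[OF _ t, where c = c, folded P u_def D_def s_def]
    have F: "D * f P = t\<^sup>2 * (u 2 * s * l3 - u 3 * t * l2)"
      unfolding curve[OF aff(1)] sum_atMost_3 vals by (simp add: power2_eq_square power3_eq_cube algebra_simps)
    have G: "D * g P = s\<^sup>2 * (u 0 * s * l1 - u 1 * t * l0)"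
      unfolding curve[OF aff(2)] sum_atMost_3 vals by (simp add: power2_eq_square power3_eq_cube algebra_simps)
    have H: "D * h P = s * t * (u 1 * s * l2 - u 2 * t * l1)"
      unfolding curve[OF aff(3)] sum_atMost_3 vals by (simp add: power2_eq_square power3_eq_cube algebra_simps)
    have "D\<^sup>2 * (l1 * l2 * f P * g P - l0 * l3 * (h P)\<^sup>2)
        = l1 * l2 * (D * f P) * (D * g P) - l0 * l3 * (D * h P)\<^sup>2"
      by (simp add: power2_eq_square algebra_simps)
    also have "\<dots> = s\<^sup>2 * t\<^sup>2 * (l2 * l3 * s\<^sup>2 * (u 0 * u 2 * l1\<^sup>2 - (u 1)\<^sup>2 * l0 * l2)
        + l0 * l1 * t\<^sup>2 * (u 1 * u 3 * l2\<^sup>2 - (u 2)\<^sup>2 * l1 * l3)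
        - l1 * l2 * s * t * (u 0 * u 3 * l1 * l2 - u 1 * u 2 * l0 * l3))"
      unfolding F G H by (simp add: power2_eq_square algebra_simps)
    also have "\<dots> = 0"
      by (simp add: p1 p2 p3)
    finally show "l1 * l2 * f P * g P - l0 * l3 * (h P)\<^sup>2 = 0"
      using t by (simp add: D_def)
  qed
qed

theorem theorem11:
  fixes c :: "nat \<Rightarrow> real ^ 2" and w :: "nat \<Rightarrow> real"
  assumes "\<And>i. i \<le> 3 \<Longrightarrow> w i \<noteq> 0"
    and "\<And>i j k. i < j \<Longrightarrow> j < k \<Longrightarrow> k \<le> 3 \<Longrightarrow> \<not> collinear {c i, c j, c k}"
  shows "degenerates_to_conic c w \<longleftrightarrow> phi1 c w = 0 \<and> phi2 c w = 0"
proof -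
  have "orient (c i) (c j) (c k) \<noteq> 0" if "i < j" "j < k" "k \<le> 3" for i j k
    using assms(2)[OF that] orient_zero_imp_collinear by blast
  then have "lambda0 c \<noteq> 0" "lambda1 c \<noteq> 0" "lambda2 c \<noteq> 0" "lambda3 c \<noteq> 0"
    by (simp_all add: lambdas_eq_orient)
  with assms(1) show ?thesis
    using phi_zero_if_degenerates degenerates_if_phi_zero by blast
qed

end
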